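(* Let $H$ be a real Hilbert space and let $F=f+g$, where $f:H\to\mathbb{R}$ is convex and $L$-smooth with $L>0$, and $g:H\to\mathbb{R}\cup\{\infty\}$ is convex, proper and lower-semicontinuous. Assume $\operatorname{argmin}(F)\neq\emptyset$, let $x^*\in\operatorname{argmin}(F)$ and $F^*=F(x^* )$. Let $s\in(0,1/L]$ and $\gamma\in(0,2-sL]$, and let $(x_k),(y_k),(z_k)$ be generated by (M-APM) from initial points $x_0,y_0\in H$. Then for every $k\ge1$, $$F(y_k)-F^*\le\frac{\|x_0-x^*\|^2}{2\gamma s t_k(t_k-1)} .$$ Besides, every weak subsequential limit point of $(y_k)$, as $k\to\infty$, minimizes $F$.
   Context: $L$-smooth means $f$ is differentiable with $L$-Lipschitz gradient. $\operatorname{prox}_{sg}(v)=\operatorname{arg\,min}_{u\in H}\{g(u)+\frac{1}{2s}\|u-v\|^2\}$. The sequence $(t_k)_{k\ge0}$ is $t_0=1$, $t_k=\frac{1+\sqrt{1+4t_{k-1}^2}}{2}$ for $k\ge1$. A weak subsequential limit point of a sequence is the weak limit of some subsequence. Algorithm (M-APM): given $x_0,y_0\in H$, for $k\ge0$, $$z_k=\operatorname{prox}_{sg}(x_k-s\nabla f(x_k)),\qquad y_{k+1}=\begin{cases}z_k,&\text{if }F(z_k)\le F(y_k),\\ y_k,&\text{otherwise},\end{cases}$$ $$x_{k+1}=y_{k+1}+\frac{t_k-1}{t_{k+1}}(y_{k+1}-y_k)+\frac{t_k}{t_{k+1}}(z_k-y_{k+1})+\frac{t_k(\gamma-1)}{t_{k+1}}(z_k-x_k).$$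 *)

theory Defs
  imports "HOL-Analysis.Analysis"
begin

(* A real Hilbert space is a type of sort {real_inner, complete_space}. *)

(* By the Riesz theorem, on a Hilbert space the gradient exists wherever f is differentiable;
   elsewhere its value is arbitrary. *)
definition gradient :: "('a::real_inner \<Rightarrow> real) \<Rightarrow> 'a \<Rightarrow> 'a"
  where "gradient f x = (THE D. GDERIV f x :> D)"

lemma gradient_eqI:
  assumes "GDERIV f x :> D"
  shows "gradient f x = D"
  unfolding gradient_def
proof (rule the_equality[where P = "\<lambda>D. GDERIV f x :> D", OF assms])
  fix E assume "GDERIV f x :> E"
  with assms have "(\<lambda>h. inner h E) = (\<lambda>h. inner h D)"
    unfolding gderiv_def by (rule has_derivative_unique[rotated])
  then show "E = D"
    by (metis vector_eq_ldot)
qed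

definition L_smooth :: "real \<Rightarrow> ('a::real_inner \<Rightarrow> real) \<Rightarrow> bool"
  where "L_smooth L f \<longleftrightarrow>
    (\<forall>x. f differentiable (at x)) \<and> L-lipschitz_on UNIV (gradient f)"

(* The range R \<union> {\<infinity>} is encoded as ereal with -\<infinity> excluded by proper_fun. *)
definition proper_fun :: "('a \<Rightarrow> ereal) \<Rightarrow> bool"
  where "proper_fun g \<longleftrightarrow> (\<forall>x. g x \<noteq> -\<infinity>) \<and> (\<exists>x. g x \<noteq> \<infinity>)"

(* Open range of weights, so that no product 0 * \<infinity> occurs. *)
definition convex_ereal :: "('a::real_vector \<Rightarrow> ereal) \<Rightarrow> bool"
  where "convex_ereal g \<longleftrightarrow>
    (\<forall>x y. \<forall>u>0. \<forall>v>0. u + v = 1 \<longrightarrow>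
      g (u *\<^sub>R x + v *\<^sub>R y) \<le> ereal u * g x + ereal v * g y)"

definition lower_semicont :: "('a::topological_space \<Rightarrow> ereal) \<Rightarrow> bool"
  where "lower_semicont g \<longleftrightarrow> (\<forall>x. g x \<le> Liminf (at x) g)"

definition composite :: "('a \<Rightarrow> real) \<Rightarrow> ('a \<Rightarrow> ereal) \<Rightarrow> 'a \<Rightarrow> ereal"
  where "composite f g x = ereal (f x) + g x"

(* prox s g v is the proximal point of s * g at v. *)
definition prox :: "real \<Rightarrow> ('a::real_inner \<Rightarrow> ereal) \<Rightarrow> 'a \<Rightarrow> 'a"
  where "prox s g v = arg_min (\<lambda>u. g u + ereal (1 / (2 * s) * (norm (u - v))\<^sup>2)) (\<lambda>_. True)"

primrec tseq :: "nat \<Rightarrow> real"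
  where
    "tseq 0 = 1"
  | "tseq (Suc k) = (1 + sqrt (1 + 4 * (tseq k)\<^sup>2)) / 2"

(* The initial points are x 0 and y 0. *)
definition generated_by_MAPM ::
  "('a::real_inner \<Rightarrow> real) \<Rightarrow> ('a \<Rightarrow> ereal) \<Rightarrow> real \<Rightarrow> real \<Rightarrow>
    (nat \<Rightarrow> 'a) \<Rightarrow> (nat \<Rightarrow> 'a) \<Rightarrow> (nat \<Rightarrow> 'a) \<Rightarrow> bool"
  where "generated_by_MAPM f g s \<gamma> x y z \<longleftrightarrow> (\<forall>k.
    z k = prox s g (x k - s *\<^sub>R gradient f (x k)) \<and>
    y (Suc k) = (if composite f g (z k) \<le> composite f g (y k) then z k else y k) \<and>
    x (Suc k) = y (Suc k)
      + ((tseq k - 1) / tseq (Suc k)) *\<^sub>R (y (Suc k) - y k)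
      + (tseq k / tseq (Suc k)) *\<^sub>R (z k - y (Suc k))
      + (tseq k * (\<gamma> - 1) / tseq (Suc k)) *\<^sub>R (z k - x k))"

definition weakly_converges :: "(nat \<Rightarrow> 'a::real_normed_vector) \<Rightarrow> 'a \<Rightarrow> bool"
  where "weakly_converges u w \<longleftrightarrow>
    (\<forall>\<phi>::'a \<Rightarrow> real. bounded_linear \<phi> \<longrightarrow> (\<lambda>n. \<phi> (u n)) \<longlonglongrightarrow> \<phi> w)"

definition weak_subseq_limit_point :: "(nat \<Rightarrow> 'a::real_normed_vector) \<Rightarrow> 'a \<Rightarrow> bool"
  where "weak_subseq_limit_point u w \<longleftrightarrow>
    (\<exists>r::nat \<Rightarrow> nat. strict_mono r \<and> weakly_converges (u \<circ> r) w)"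

end

theory Submission
  imports Defs
begin

text \<open>
  Testing the proximal-gradient inequality at \<open>y\<^sub>k\<close> and at \<open>x\<^sup>*\<close> with weights \<open>t\<^sub>k - 1\<close> and \<open>1\<close> shows
  that \<open>2\<gamma>s(t\<^sub>k\<^sup>2 - t\<^sub>k)(F(y\<^sub>k) - F\<^sup>*) + \<parallel>t\<^sub>k x\<^sub>k - (t\<^sub>k - 1) y\<^sub>k - x\<^sup>*\<parallel>\<^sup>2\<close> is nonincreasing: the update of
  \<open>x\<close> is exactly the one that completes the square, and \<open>t\<^sub>k\<^sup>2 = t\<^sub>k\<^sub>+\<^sub>1\<^sup>2 - t\<^sub>k\<^sub>+\<^sub>1\<close>. For a weak limit point
  \<open>w\<close>, the variational inequality of \<open>p = prox F w\<close> tested along the subsequence gives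
  \<open>F\<^sup>* \<ge> F(p) + \<parallel>w - p\<parallel>\<^sup>2\<close>, whence \<open>w = p\<close> is a minimizer. The same existence result for
  proximal points yields the Riesz representation of the derivative of \<open>f\<close>.
\<close>

section \<open>Proximal points of convex lower semicontinuous functions\<close>

lemma convex_ereal_finite:
  assumes "convex_ereal G" "G u = ereal a" "G w = ereal b" "0 < \<theta>" "\<theta> < 1"
  shows "G (u + \<theta> *\<^sub>R (w - u)) \<le> ereal ((1 - \<theta>) * a + \<theta> * b)"
proof -
  have "G ((1 - \<theta>) *\<^sub>R u + \<theta> *\<^sub>R w) \<le> ereal (1 - \<theta>) * G u + ereal \<theta> * G w"
    using assms(1,4,5)[unfolded convex_ereal_def] by (metis diff_gt_0_iff_gt diff_add_cancel)
  moreover have "(1 - \<theta>) *\<^sub>R u + \<theta> *\<^sub>R w = u + \<theta> *\<^sub>R (w - u)"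
    by (simp add: algebra_simps)
  ultimately show ?thesis
    using assms by simp
qed

text \<open>\<open>Liminf\<close> ranges over punctured neighbourhoods; the premise
  \<open>c < G x\<close> covers the centre, so \<open>nhds\<close> may replace \<open>at\<close>. In
  this form it applies to sequences that may hit their limit.\<close>

lemma lower_semicont_iff:
  "lower_semicont G \<longleftrightarrow> (\<forall>x c. c < G x \<longrightarrow> eventually (\<lambda>u. c < G u) (nhds x))"
proof -
  have "(c < G x \<longrightarrow> eventually (\<lambda>u. c < G u) (at x))
      \<longleftrightarrow> (c < G x \<longrightarrow> eventually (\<lambda>u. c < G u) (nhds x))" for x c
    unfolding eventually_at_filter by (auto elim: eventually_mono)
  then show ?thesis
    unfolding lower_semicont_def le_Liminf_iff by blast
qed

text \<open>The quadratic makes the objective strongly convex, so minimizing sequences are Cauchy;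
  completeness supplies a limit, and lower semicontinuity shows that the infimum is attained there.
  \<open>below\<close> keeps the infimum finite.\<close>

lemma prox_objective_attains:
  fixes G :: "'a::{real_inner, complete_space} \<Rightarrow> ereal"
  assumes conv: "convex_ereal G" and proper: "proper_fun G" and lsc: "lower_semicont G"
    and c: "c > 0" and below: "\<And>u. ereal B \<le> G u + ereal (c * (norm (u - v))\<^sup>2)"
  shows "\<exists>p a. G p = ereal a \<and> (\<forall>u. ereal (a + c * (norm (p - v))\<^sup>2) \<le> G u + ereal (c * (norm (u - v))\<^sup>2))"
proof -
  define h where "h = (\<lambda>u. G u + ereal (c * (norm (u - v))\<^sup>2))"
  obtain u0 b0 where u0: "G u0 = ereal b0"
    using proper unfolding proper_fun_def by (metis ereal_cases)
  have "(INF u. h u) \<noteq> \<infinity>"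
    using INF_lower[of u0 UNIV h] u0 by (auto simp: h_def)
  moreover have "(INF u. h u) \<noteq> -\<infinity>"
    using INF_greatest[of UNIV "ereal B" h] below by (auto simp: h_def)
  ultimately obtain m where m: "(INF u. h u) = ereal m"
    by (metis ereal_cases)
  have mle: "ereal m \<le> h u" for u
    using INF_lower[of u UNIV h] m by simp
  have "\<exists>u a. G u = ereal a \<and> a + c * (norm (u - v))\<^sup>2 < m + 1 / (Suc n)" for n
  proof -
    have "(INF u. h u) < ereal (m + 1 / (Suc n))"
      using m by simp
    then obtain u where u: "h u < ereal (m + 1 / (Suc n))"
      by (auto simp: INF_less_iff)
    then have "G u \<noteq> \<infinity>" by (auto simp: h_def)
    moreover have "G u \<noteq> -\<infinity>" using proper by (simp add: proper_fun_def)
    ultimately obtain a where "G u = ereal a" by (metis ereal_cases)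
    with u show ?thesis by (auto simp: h_def)
  qed
  then obtain u a where ua: "\<And>n. G (u n) = ereal (a n)"
    "\<And>n. a n + c * (norm (u n - v))\<^sup>2 < m + 1 / (Suc n)"
    by metis
  \<comment> \<open>At the midpoint the objective is at least \<open>m\<close>, while convexity and
    the parallelogram identity bound it by the average of the two end values minus
    \<open>c / 4\<close> times the squared distance.\<close>
  have key: "c * (norm (u j - u i))\<^sup>2 \<le> 2 * (1 / Suc i + 1 / Suc j)" for i j
  proof -
    let ?w = "u i + (1/2) *\<^sub>R (u j - u i)"
    have "G ?w \<le> ereal ((1 - 1/2) * a i + 1/2 * a j)"
      by (rule convex_ereal_finite[OF conv ua(1) ua(1)]) auto
    then have "ereal m \<le> ereal ((1 - 1/2) * a i + 1/2 * a j) + ereal (c * (norm (?w - v))\<^sup>2)"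
      using mle[of ?w] unfolding h_def by (meson add_mono order.trans order_refl)
    then have 1: "m \<le> (a i + a j) / 2 + c * (norm (?w - v))\<^sup>2"
      by (simp add: add_divide_distrib)
    have "?w - v = (1/2) *\<^sub>R ((u i - v) + (u j - v))"
      by (simp add: algebra_simps flip: scaleR_left_distrib)
    moreover have "(norm ((1/2) *\<^sub>R (p + q)))\<^sup>2 = ((norm p)\<^sup>2 + (norm q)\<^sup>2) / 2 - (norm (q - p))\<^sup>2 / 4"
      for p q :: 'a
      by (simp add: power2_norm_eq_inner inner_add_left inner_add_right inner_diff_left inner_diff_right
          inner_commute[of q p] power_mult_distrib algebra_simps) (simp add: power2_eq_square field_simps)
    from this[of "u i - v" "u j - v"] calculation have "(norm (?w - v))\<^sup>2 =
        ((norm (u i - v))\<^sup>2 + (norm (u j - v))\<^sup>2) / 2 - (norm (u j - u i))\<^sup>2 / 4"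
      by simp
    with 1 have "m \<le> (a i + a j) / 2
        + c * (((norm (u i - v))\<^sup>2 + (norm (u j - v))\<^sup>2) / 2 - (norm (u j - u i))\<^sup>2 / 4)"
      by simp
    then have "m \<le> (a i + a j) / 2
        + (c * (norm (u i - v))\<^sup>2 + c * (norm (u j - v))\<^sup>2) / 2 - c * (norm (u j - u i))\<^sup>2 / 4"
      by (simp add: algebra_simps)
    with ua(2)[of i] ua(2)[of j] show ?thesis
      by argo
  qed
  have "Cauchy u"
  proof (rule metric_CauchyI)
    fix e :: real assume e: "e > 0"
    then have "c * e\<^sup>2 / 4 > 0" using c by simp
    then obtain N where N: "1 / Suc N < c * e\<^sup>2 / 4"
      using nat_approx_posE by blast
    show "\<exists>M. \<forall>i\<ge>M. \<forall>j\<ge>M. dist (u i) (u j) < e"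
    proof (intro exI allI impI)
      fix i j assume "N \<le> i" "N \<le> j"
      then have "1 / real (Suc i) \<le> 1 / Suc N" "1 / real (Suc j) \<le> 1 / Suc N"
        by (auto intro!: divide_left_mono)
      then have "c * (norm (u j - u i))\<^sup>2 < c * e\<^sup>2"
        using key[of j i] N by argo
      then have "(norm (u j - u i))\<^sup>2 < e\<^sup>2" using c by simp
      then show "dist (u i) (u j) < e"
        using e by (simp add: dist_norm norm_minus_commute power_less_imp_less_base)
    qed
  qed
  then obtain p where p: "u \<longlonglongrightarrow> p"
    using Cauchy_convergent_iff convergent_def by blast
  have "(\<lambda>n. m + inverse (real (Suc n)) - c * (norm (u n - v))\<^sup>2) \<longlonglongrightarrow> m + 0 - c * (norm (p - v))\<^sup>2"
    by (intro tendsto_intros p LIMSEQ_inverse_real_of_nat)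
  then have lim: "(\<lambda>n. m + 1 / Suc n - c * (norm (u n - v))\<^sup>2) \<longlonglongrightarrow> m - c * (norm (p - v))\<^sup>2"
    by (simp add: inverse_eq_divide)
  have Gp: "G p \<le> ereal (m - c * (norm (p - v))\<^sup>2)"
  proof (rule ccontr)
    assume "\<not> ?thesis"
    then have "ereal (m - c * (norm (p - v))\<^sup>2) < G p" by simp
    \<comment> \<open>A level \<open>r\<close> strictly in between is eventually below
      \<open>G (u n) = a n\<close> by lower semicontinuity, yet eventually above the upper bound on
      \<open>a n\<close>.\<close>
    then obtain r where r: "m - c * (norm (p - v))\<^sup>2 < r" "ereal r < G p"
      using ereal_dense2[of "ereal (m - c * (norm (p - v))\<^sup>2)" "G p"] by auto
    have "eventually (\<lambda>n. ereal r < G (u n)) sequentially"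
      using lsc r(2) p unfolding lower_semicont_iff filterlim_iff by blast
    moreover have "eventually (\<lambda>n. m + 1 / Suc n - c * (norm (u n - v))\<^sup>2 < r) sequentially"
      using order_tendstoD(2)[OF lim r(1)] .
    ultimately have "eventually (\<lambda>n. False) sequentially"
    proof eventually_elim
      case (elim n)
      then show ?case using ua(1)[of n] ua(2)[of n] by simp
    qed
    then show False by simp
  qed
  moreover have "G p \<noteq> -\<infinity>" using proper by (simp add: proper_fun_def)
  ultimately obtain q where q: "G p = ereal q" by (cases "G p") auto
  have "ereal (q + c * (norm (p - v))\<^sup>2) \<le> h w" for w
    using Gp q mle[of w] by (metis (no_types, opaque_lifting) add.commute ereal_less_eq(3) le_diff_eq order_trans)
  then show ?thesis
    using q unfolding h_def by blast
qed

text \<open>First-order optimality: compare the proximal point with points on the segment towards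
  \<open>u\<close>, divide by the segment parameter and let it tend to 0.\<close>

lemma prox_variational:
  fixes G :: "'a::{real_inner, complete_space} \<Rightarrow> ereal"
  assumes conv: "convex_ereal G" and proper: "proper_fun G" and lsc: "lower_semicont G"
    and s: "s > 0" and below: "\<And>u. ereal B \<le> G u + ereal (1 / (2 * s) * (norm (u - v))\<^sup>2)"
  obtains a where "G (prox s G v) = ereal a"
    and "\<And>u b. G u = ereal b \<Longrightarrow> a + inner (v - prox s G v) (u - prox s G v) / s \<le> b"
proof -
  define h where "h = (\<lambda>u. G u + ereal (1 / (2 * s) * (norm (u - v))\<^sup>2))"
  define p where "p = prox s G v"
  obtain p' a' where p': "G p' = ereal a'" "\<And>u. ereal (a' + 1 / (2 * s) * (norm (p' - v))\<^sup>2) \<le> h u"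
    using prox_objective_attains[OF conv proper lsc _ below] s unfolding h_def by auto
  have "is_arg_min h (\<lambda>_. True) p'"
    using p' by (auto simp: is_arg_min_def h_def not_less)
  \<comment> \<open>\<open>arg_min\<close> chooses among the minimizers, so the existence of
    \<open>p'\<close> makes the chosen point a minimizer too.\<close>
  then have "is_arg_min h (\<lambda>_. True) p"
    unfolding p_def prox_def arg_min_def h_def by (rule someI)
  then have pmin: "h p \<le> h u" for u
    by (auto simp: is_arg_min_def not_less)
  have "G p \<noteq> \<infinity>"
    using pmin[of p'] p'(1) by (auto simp: h_def)
  moreover have "G p \<noteq> -\<infinity>" using proper by (simp add: proper_fun_def)
  ultimately obtain a where a: "G p = ereal a" by (metis ereal_cases)
  have "a + inner (v - p) (u - p) / s \<le> b" if b: "G u = ereal b" for u b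
  proof -
    \<comment> \<open>\<open>K\<close> is the coefficient of \<open>\<theta>\<close> squared in the
      expanded quadratic; after division by \<open>\<theta>\<close> it leaves the error
      \<open>\<theta> * K\<close>.\<close>
    define K where "K = 1 / (2 * s) * (norm (u - p))\<^sup>2"
    have step: "a + inner (v - p) (u - p) / s - b \<le> \<theta> * K" if \<theta>: "0 < \<theta>" "\<theta> < 1" for \<theta>
    proof -
      let ?w = "p + \<theta> *\<^sub>R (u - p)"
      have "h p \<le> ereal ((1 - \<theta>) * a + \<theta> * b) + ereal (1 / (2 * s) * (norm (?w - v))\<^sup>2)"
        using pmin[of ?w] convex_ereal_finite[OF conv a b \<theta>] unfolding h_def
        by (meson add_mono order.trans order_refl)
      then have 1: "a + 1 / (2 * s) * (norm (p - v))\<^sup>2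
          \<le> (1 - \<theta>) * a + \<theta> * b + 1 / (2 * s) * (norm (?w - v))\<^sup>2"
        by (simp add: h_def a)
      have "?w - v = (p - v) + \<theta> *\<^sub>R (u - p)" by simp
      then have "(norm (?w - v))\<^sup>2 = (norm (p - v))\<^sup>2 - 2 * \<theta> * inner (v - p) (u - p) + \<theta>\<^sup>2 * (norm (u - p))\<^sup>2"
        by (simp only: power2_norm_eq_inner)
          (simp add: inner_add_left inner_add_right inner_diff_left inner_diff_right inner_commute power2_eq_square algebra_simps)
      then have "1 / (2 * s) * (norm (?w - v))\<^sup>2
          = 1 / (2 * s) * (norm (p - v))\<^sup>2 - \<theta> * (inner (v - p) (u - p) / s) + \<theta> * (\<theta> * K)"
        using s by (simp add: K_def field_simps power2_eq_square)
      with 1 have "\<theta> * (a + inner (v - p) (u - p) / s - b) \<le> \<theta> * (\<theta> * K)"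
        by (simp add: algebra_simps)
      then show ?thesis using \<theta> by simp
    qed
    have "((\<lambda>\<theta>. \<theta> * K) \<longlongrightarrow> 0 * K) (at_right 0)"
      by (intro tendsto_intros)
    moreover have "eventually (\<lambda>\<theta>. a + inner (v - p) (u - p) / s - b \<le> \<theta> * K) (at_right (0::real))"
      by (rule eventually_mono[OF eventually_at_right_real[of 0 1]]) (auto intro: step)
    ultimately have "a + inner (v - p) (u - p) / s - b \<le> 0 * K"
      by (intro tendsto_lowerbound[of _ "0 * K" "at_right (0::real)"]) auto
    then show ?thesis by simp
  qed
  with a show ?thesis
    using that unfolding p_def by blast
qed

section \<open>Sums of a real-valued and an extended-valued function\<close>

lemma lower_semicont_continuous_add:
  fixes G :: "'a::topological_space \<Rightarrow> ereal"
  assumes f: "continuous_on UNIV f" and G: "lower_semicont G" "proper_fun G"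
  shows "lower_semicont (composite f G)"
  unfolding lower_semicont_iff
proof (intro allI impI)
  fix x c assume c: "c < composite f G x"
  show "eventually (\<lambda>u. c < composite f G u) (nhds x)"
  proof (cases c)
    case (real a)
    then have "ereal (a - f x) < G x"
      using c by (cases "G x") (auto simp: composite_def)
    \<comment> \<open>\<open>b\<close> splits the level \<open>a\<close>: near \<open>x\<close>,
      \<open>G u > b\<close> by semicontinuity and \<open>f u > a - b\<close> by continuity.\<close>
    then obtain b where b: "a - f x < b" "ereal b < G x"
      using ereal_dense2[of "ereal (a - f x)" "G x"] by auto
    have "eventually (\<lambda>u. ereal b < G u) (nhds x)"
      using G(1) b(2) by (simp add: lower_semicont_iff)
    moreover have "(f \<longlongrightarrow> f x) (nhds x)"
      using f by (simp add: continuous_on_def tendsto_at_iff_tendsto_nhds)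
    then have "eventually (\<lambda>u. a - b < f u) (nhds x)"
      by (rule order_tendstoD) (use b in linarith)
    ultimately show ?thesis
    proof eventually_elim
      case (elim u)
      then show ?case
        using real by (cases "G u") (auto simp: composite_def)
    qed
  next
    case MInf
    then show ?thesis
      using G(2) by (simp add: composite_def proper_fun_def)
  qed (use c in simp)
qed

lemma convex_ereal_add:
  assumes f: "convex_on UNIV f" and G: "convex_ereal G" and "proper_fun G"
  shows "convex_ereal (composite f G)"
  unfolding convex_ereal_def
proof (intro allI impI)
  fix x y and u v :: real
  assume uv: "0 < u" "0 < v" "u + v = 1"
  have 1: "f (u *\<^sub>R x + v *\<^sub>R y) \<le> u * f x + v * f y"
    using f uv by (auto simp: convex_on_def)
  have "G (u *\<^sub>R x + v *\<^sub>R y) \<le> ereal u * G x + ereal v * G y"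
    using G uv by (auto simp: convex_ereal_def)
  with 1 have "composite f G (u *\<^sub>R x + v *\<^sub>R y)
      \<le> ereal (u * f x + v * f y) + (ereal u * G x + ereal v * G y)"
    unfolding composite_def by (intro add_mono) auto
  also have "\<dots> = ereal u * composite f G x + ereal v * composite f G y"
    using uv \<open>proper_fun G\<close> unfolding composite_def proper_fun_def
    by (cases "G x"; cases "G y") (auto simp: algebra_simps)
  finally show "composite f G (u *\<^sub>R x + v *\<^sub>R y)
      \<le> ereal u * composite f G x + ereal v * composite f G y" .
qed

lemma proper_fun_composite: "proper_fun G \<Longrightarrow> proper_fun (composite f G)"
  unfolding proper_fun_def composite_def by auto

section \<open>Gradients as Riesz representatives\<close>

text \<open>The representing vector minimizes half the squared norm minus \<open>\<phi>\<close>, so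
  it is the proximal point of \<open>- \<phi>\<close> at 0 with parameter 1.\<close>

lemma riesz_representation:
  fixes \<phi> :: "'a::{real_inner, complete_space} \<Rightarrow> real"
  assumes "bounded_linear \<phi>"
  obtains p where "\<And>h. \<phi> h = inner h p"
proof -
  interpret bounded_linear \<phi> by fact
  define G where "G = (\<lambda>u. ereal (- \<phi> u))"
  obtain K where K: "\<And>u. norm (\<phi> u) \<le> norm u * K"
    using bounded by blast
  have lsc: "lower_semicont G"
    unfolding lower_semicont_iff
  proof (intro allI impI)
    fix x c assume "c < G x"
    moreover have "(G \<longlongrightarrow> G x) (nhds x)"
      unfolding G_def using tendsto[OF tendsto_ident_at, of x UNIV]
      by (simp add: tendsto_at_iff_tendsto_nhds tendsto_minus)
    ultimately show "eventually (\<lambda>u. c < G u) (nhds x)"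
      by (rule order_tendstoD(1)[rotated])
  qed
  have conv: "convex_ereal G"
    unfolding convex_ereal_def G_def by (simp add: add scaleR)
  have proper: "proper_fun G" by (simp add: proper_fun_def G_def)
  have below: "ereal (- (K\<^sup>2 / 2)) \<le> G u + ereal (1 / (2 * 1) * (norm (u - 0))\<^sup>2)" for u
  proof -
    have "\<phi> u \<le> norm u * K" using K[of u] by simp
    moreover have "0 \<le> (norm u - K)\<^sup>2" by simp
    ultimately show ?thesis by (simp add: G_def power2_eq_square algebra_simps)
  qed
  obtain a where a: "G (prox 1 G 0) = ereal a"
    and var: "\<And>u b. G u = ereal b \<Longrightarrow> a + inner (0 - prox 1 G 0) (u - prox 1 G 0) / 1 \<le> b"
    using prox_variational[OF conv proper lsc _ below] by auto
  define p where "p = prox 1 G 0"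
  \<comment> \<open>Testing at \<open>p + h\<close> cancels \<open>\<phi> p\<close>; using both
    \<open>h\<close> and \<open>- h\<close> then upgrades the inequality to equality.\<close>
  have le: "\<phi> h \<le> inner h p" for h
    using var[of "p + h" "- \<phi> (p + h)"] a unfolding p_def[symmetric] by (simp add: G_def add inner_commute)
  have "\<phi> h = inner h p" for h
    using le[of h] le[of "- h"] by (simp add: neg)
  then show ?thesis by (rule that)
qed

text \<open>Riesz supplies a vector for the derivative, so the definite description in
  \<open>gradient\<close> denotes it.\<close>

lemma differentiable_GDERIV_gradient:
  fixes f :: "'a::{real_inner, complete_space} \<Rightarrow> real"
  assumes "f differentiable (at x)"
  shows "GDERIV f x :> gradient f x"
proof -
  obtain D where D: "(f has_derivative D) (at x)"
    using assms by (auto simp: differentiable_def)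
  then obtain p where "\<And>h. D h = inner h p"
    using riesz_representation[OF has_derivative_bounded_linear] by blast
  then have "D = (\<lambda>h. inner h p)" by auto
  with D have "GDERIV f x :> p" by (simp add: gderiv_def)
  then show ?thesis by (metis gradient_eqI)
qed

section \<open>First-order inequalities for \<open>f\<close> and the proximal-gradient step\<close>

lemma GDERIV_along_line:
  fixes f :: "'a::real_inner \<Rightarrow> real"
  assumes "GDERIV f (x + t *\<^sub>R h) :> D"
  shows "((\<lambda>t. f (x + t *\<^sub>R h)) has_real_derivative inner h D) (at t)"
proof -
  have "((\<lambda>t. x + t *\<^sub>R h) has_derivative (\<lambda>r. r *\<^sub>R h)) (at t)"
    by (auto intro!: derivative_eq_intros)
  then have "((\<lambda>t. f (x + t *\<^sub>R h)) has_derivative (\<lambda>r. inner (r *\<^sub>R h) D)) (at t)"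
    using assms unfolding gderiv_def by (rule has_derivative_compose)
  then have "((\<lambda>t. f (x + t *\<^sub>R h)) has_derivative (\<lambda>r. inner h D * r)) (at t)"
    by (simp add: mult.commute)
  then show ?thesis
    by (simp add: has_field_derivative_def)
qed

text \<open>On the line through \<open>x\<close> and \<open>u\<close> this is the tangent inequality
  for a convex function of one real variable, with tangent point 0 and value at 1.\<close>

lemma convex_gradient_le:
  fixes f :: "'a::real_inner \<Rightarrow> real"
  assumes "convex_on UNIV f" "GDERIV f x :> D"
  shows "f x + inner D (u - x) \<le> f u"
proof -
  let ?\<phi> = "\<lambda>t::real. f (x + t *\<^sub>R (u - x))"
  have "convex_on UNIV ?\<phi>"
  proof (rule convex_onI)
    fix t a b :: real assume t: "0 < t" "t < 1"
    have "x + ((1 - t) *\<^sub>R a + t *\<^sub>R b) *\<^sub>R (u - x)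
        = (1 - t) *\<^sub>R (x + a *\<^sub>R (u - x)) + t *\<^sub>R (x + b *\<^sub>R (u - x))"
      by (simp add: algebra_simps)
    then show "?\<phi> ((1 - t) *\<^sub>R a + t *\<^sub>R b) \<le> (1 - t) * ?\<phi> a + t * ?\<phi> b"
      using convex_onD[OF assms(1), of t "x + a *\<^sub>R (u - x)" "x + b *\<^sub>R (u - x)"] t by simp
  qed simp
  moreover have "(?\<phi> has_real_derivative inner (u - x) D) (at 0)"
    by (rule GDERIV_along_line) (use assms in simp)
  ultimately have "?\<phi> 1 - ?\<phi> 0 \<ge> inner (u - x) D * (1 - 0)"
    by (intro convex_on_imp_above_tangent[where A = UNIV and c = 0]) auto
  then show ?thesis by (simp add: inner_commute)
qed

text \<open>Along the segment, \<open>f\<close> minus the linear and quadratic terms of the model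
  has nonpositive derivative, by Cauchy-Schwarz and the Lipschitz bound.\<close>

lemma L_smooth_descent:
  fixes f :: "'a::{real_inner, complete_space} \<Rightarrow> real"
  assumes "L_smooth L f"
  shows "f u \<le> f x + inner (gradient f x) (u - x) + L / 2 * (norm (u - x))\<^sup>2"
proof -
  define h where "h = u - x"
  let ?\<psi> = "\<lambda>t::real. f (x + t *\<^sub>R h) - t * inner h (gradient f x) - L / 2 * t\<^sup>2 * (norm h)\<^sup>2"
  have GD: "GDERIV f y :> gradient f y" for y
    using assms by (auto simp: L_smooth_def intro: differentiable_GDERIV_gradient)
  have lip: "L-lipschitz_on UNIV (gradient f)"
    using assms by (simp add: L_smooth_def)
  have "?\<psi> 0 \<ge> ?\<psi> 1"
  proof (rule DERIV_nonpos_imp_nonincreasing[where f = ?\<psi>])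
    fix t :: real assume t: "0 \<le> t" "t \<le> 1"
    let ?d = "inner h (gradient f (x + t *\<^sub>R h)) - inner h (gradient f x) - L * t * (norm h)\<^sup>2"
    have "(?\<psi> has_real_derivative ?d) (at t)"
      by (auto intro!: derivative_eq_intros GDERIV_along_line[OF GD])
    moreover have "?d \<le> 0"
    proof -
      have "inner h (gradient f (x + t *\<^sub>R h)) - inner h (gradient f x)
          \<le> norm h * norm (gradient f (x + t *\<^sub>R h) - gradient f x)"
        using norm_cauchy_schwarz by (simp flip: inner_diff_right)
      also have "norm (gradient f (x + t *\<^sub>R h) - gradient f x) \<le> L * (t * norm h)"
        using lipschitz_onD[OF lip, of "x + t *\<^sub>R h" x] t by (simp add: dist_norm)
      then have "norm h * norm (gradient f (x + t *\<^sub>R h) - gradient f x) \<le> norm h * (L * (t * norm h))"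
        by (intro mult_left_mono) auto
      finally show ?thesis by (simp add: power2_eq_square algebra_simps)
    qed
    ultimately show "\<exists>y. (?\<psi> has_real_derivative y) (at t) \<and> y \<le> 0" by blast
  qed simp
  then show ?thesis
    by (simp add: h_def inner_commute)
qed

text \<open>Adds the optimality of \<open>z\<close>, convexity of \<open>f\<close> at
  \<open>x\<close> and the descent inequality from \<open>x\<close> to \<open>z\<close>. The last
  coefficient is \<open>1 / s\<close> from the proximal step minus \<open>L / 2\<close> from
  descent.\<close>

lemma prox_gradient_inequality:
  fixes f :: "'a::{real_inner, complete_space} \<Rightarrow> real"
  assumes f: "convex_on UNIV f" "L_smooth L f"
    and g: "convex_ereal g" "proper_fun g" "lower_semicont g"
    and L: "0 < L" and s: "0 < s" "s \<le> 1 / L"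
    and below: "\<And>u. ereal m \<le> composite f g u"
    and z: "z = prox s g (x - s *\<^sub>R gradient f x)"
  obtains c where "composite f g z = ereal c"
    and "\<And>u b. composite f g u = ereal b \<Longrightarrow>
      c + inner (x - z) (u - x) / s + (2 - s * L) / (2 * s) * (norm (x - z))\<^sup>2 \<le> b"
proof -
  define v where "v = x - s *\<^sub>R gradient f x"
  \<comment> \<open>Since \<open>L \<le> 1 / s\<close>, expanding the square and the descent
    inequality bound the quadratic below by \<open>f u\<close> plus the constant
    \<open>B - m\<close>; adding \<open>g u\<close> gives at least \<open>B\<close>.\<close>
  define B where "B = m - f x + s / 2 * (norm (gradient f x))\<^sup>2"
  have Ls: "L \<le> 1 / s" using s L by (simp add: field_simps)
  have below': "ereal B \<le> g u + ereal (1 / (2 * s) * (norm (u - v))\<^sup>2)" for u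
  proof -
    have "u - v = (u - x) + s *\<^sub>R gradient f x" by (simp add: v_def)
    then have "(norm (u - v))\<^sup>2 = (norm (u - x))\<^sup>2 + 2 * s * inner (gradient f x) (u - x)
        + s\<^sup>2 * (norm (gradient f x))\<^sup>2"
      by (simp only: power2_norm_eq_inner)
        (simp add: inner_add_left inner_add_right inner_commute power2_eq_square algebra_simps)
    then have "1 / (2 * s) * (norm (u - v))\<^sup>2 = 1 / (2 * s) * (norm (u - x))\<^sup>2
        + inner (gradient f x) (u - x) + s / 2 * (norm (gradient f x))\<^sup>2"
      using s by (simp add: field_simps power2_eq_square)
    moreover have "L / 2 * (norm (u - x))\<^sup>2 \<le> 1 / (2 * s) * (norm (u - x))\<^sup>2"
      using Ls by (intro mult_right_mono) auto
    ultimately have "f u - f x + s / 2 * (norm (gradient f x))\<^sup>2 \<le> 1 / (2 * s) * (norm (u - v))\<^sup>2"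
      using L_smooth_descent[OF f(2), of u x] by linarith
    then show ?thesis
      using below[of u] by (cases "g u") (auto simp: composite_def B_def)
  qed
  obtain a where a: "g z = ereal a"
    and var: "\<And>u b. g u = ereal b \<Longrightarrow> a + inner (v - z) (u - z) / s \<le> b"
    using prox_variational[OF g s(1) below'] unfolding z v_def by metis
  show ?thesis
  proof (rule that)
    show "composite f g z = ereal (f z + a)" by (simp add: composite_def a)
    fix u b assume "composite f g u = ereal b"
    then have gu: "g u = ereal (b - f u)"
      by (cases "g u") (auto simp: composite_def)
    have "GDERIV f x :> gradient f x"
      using f by (auto simp: L_smooth_def intro: differentiable_GDERIV_gradient)
    then have 1: "f x + inner (gradient f x) (u - x) \<le> f u"
      by (rule convex_gradient_le[OF f(1)])
    have 2: "f z \<le> f x + inner (gradient f x) (z - x) + L / 2 * (norm (x - z))\<^sup>2"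
      using L_smooth_descent[OF f(2), of z x] by (simp add: norm_minus_commute)
    have "inner (v - z) (u - z)
        = inner (x - z) (u - x) + (norm (x - z))\<^sup>2 - s * inner (gradient f x) (u - z)"
      unfolding v_def
      by (simp only: power2_norm_eq_inner)
        (simp add: inner_add_left inner_add_right inner_diff_left inner_diff_right inner_commute algebra_simps)
    then have 3: "inner (v - z) (u - z) / s
        = inner (x - z) (u - x) / s + (norm (x - z))\<^sup>2 / s - inner (gradient f x) (u - z)"
      using s by (simp add: field_simps)
    \<comment> \<open>Splitting at \<open>x\<close> lets convexity absorb the part towards
      \<open>u\<close> and descent the part towards \<open>z\<close>.\<close>
    have 4: "inner (gradient f x) (u - z) = inner (gradient f x) (u - x) - inner (gradient f x) (z - x)"
      by (simp flip: inner_diff_right)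
    have 5: "(2 - s * L) / (2 * s) * (norm (x - z))\<^sup>2 = (norm (x - z))\<^sup>2 / s - L / 2 * (norm (x - z))\<^sup>2"
      using s by (simp add: field_simps)
    show "f z + a + inner (x - z) (u - x) / s + (2 - s * L) / (2 * s) * (norm (x - z))\<^sup>2 \<le> b"
      using var[OF gu] 1 2 3 4 5 by linarith
  qed
qed

section \<open>The sequence \<open>tseq\<close> and the one-step estimate\<close>

text \<open>The square root is at least \<open>2 * tseq k\<close>, so each step gains at least
  1/2.\<close>

lemma tseq_ge: "tseq k \<ge> (real k + 2) / 2"
proof (induction k)
  case (Suc k)
  have "2 * tseq k \<le> sqrt (1 + 4 * (tseq k)\<^sup>2)"
    by (rule real_le_rsqrt) (simp add: power2_eq_square)
  with Suc show ?case by simp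
qed simp

text \<open>The recursion takes the positive root of a quadratic equation, so that the weight
  produced by one step is the weight entering the next.\<close>

lemma tseq_Suc_mult: "tseq (Suc k) * (tseq (Suc k) - 1) = (tseq k)\<^sup>2"
proof -
  have "(sqrt (1 + 4 * (tseq k)\<^sup>2))\<^sup>2 = 1 + 4 * (tseq k)\<^sup>2"
    by (simp add: add_nonneg_nonneg)
  then show ?thesis
    by (simp add: power2_eq_square field_simps)
qed

text \<open>The premise \<open>t \<noteq> 1\<close> covers \<open>k = 0\<close>: there \<open>F(y\<^sub>0)\<close> may be infinite, but its weight
  \<open>t\<^sub>0(t\<^sub>0 - 1)\<close> vanishes.\<close>

lemma MAPM_step:
  fixes x y z xstar d :: "'a::real_inner"
  assumes s: "0 < s" and \<gamma>: "0 < \<gamma>" "\<gamma> \<le> 2 - s * L" and t: "1 \<le> t"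
    and d: "d = x - z"
    and star: "\<zeta> + inner d (xstar - x) / s + (2 - s * L) / (2 * s) * (norm d)\<^sup>2 \<le> 0"
    and yk: "t \<noteq> 1 \<Longrightarrow> \<zeta> + inner d (y - x) / s + (2 - s * L) / (2 * s) * (norm d)\<^sup>2 \<le> \<delta>"
  shows "2 * \<gamma> * s * t\<^sup>2 * \<zeta> + (norm (t *\<^sub>R x - (t - 1) *\<^sub>R y - xstar - (\<gamma> * t) *\<^sub>R d))\<^sup>2
    \<le> 2 * \<gamma> * s * (t * (t - 1)) * \<delta> + (norm (t *\<^sub>R x - (t - 1) *\<^sub>R y - xstar))\<^sup>2"
proof -
  define w where "w = t *\<^sub>R x - (t - 1) *\<^sub>R y - xstar"
  \<comment> \<open>The bound on \<open>\<gamma>\<close> permits lowering the coefficient to the one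
    that completes the square below.\<close>
  have rel: "\<gamma> / (2 * s) * (norm d)\<^sup>2 \<le> (2 - s * L) / (2 * s) * (norm d)\<^sup>2"
    using s \<gamma> by (intro mult_right_mono divide_right_mono) auto
  have 1: "\<zeta> + inner d (xstar - x) / s + \<gamma> / (2 * s) * (norm d)\<^sup>2 \<le> 0"
    using star rel by linarith
  have 2: "(t - 1) * (\<zeta> + inner d (y - x) / s + \<gamma> / (2 * s) * (norm d)\<^sup>2) \<le> (t - 1) * \<delta>"
  proof (cases "t = 1")
    case False
    then show ?thesis using yk rel t by (intro mult_left_mono) auto
  qed simp
  \<comment> \<open>The weights 1 and \<open>t - 1\<close> sum to \<open>t\<close>, and the weighted
    directions \<open>xstar - x\<close> and \<open>y - x\<close> sum to \<open>- w\<close>.\<close>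
  have "(\<zeta> + inner d (xstar - x) / s + \<gamma> / (2 * s) * (norm d)\<^sup>2)
      + (t - 1) * (\<zeta> + inner d (y - x) / s + \<gamma> / (2 * s) * (norm d)\<^sup>2)
      = t * \<zeta> - inner d w / s + t * (\<gamma> / (2 * s) * (norm d)\<^sup>2)"
    unfolding w_def
    by (simp add: inner_diff_right inner_commute diff_divide_distrib add_divide_distrib algebra_simps)
  with 1 2 have 3: "t * \<zeta> - inner d w / s + t * (\<gamma> / (2 * s) * (norm d)\<^sup>2) \<le> (t - 1) * \<delta>"
    by linarith
  have "(2 * \<gamma> * s * t) * (t * \<zeta> - inner d w / s + t * (\<gamma> / (2 * s) * (norm d)\<^sup>2))
      \<le> (2 * \<gamma> * s * t) * ((t - 1) * \<delta>)"
    using 3 s \<gamma> t by (intro mult_left_mono) auto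
  moreover have "(2 * \<gamma> * s * t) * (t * \<zeta> - inner d w / s + t * (\<gamma> / (2 * s) * (norm d)\<^sup>2))
      = 2 * \<gamma> * s * t\<^sup>2 * \<zeta> - 2 * (\<gamma> * t) * inner d w + (\<gamma> * t)\<^sup>2 * (norm d)\<^sup>2"
    using s by (simp add: field_simps power2_eq_square)
  moreover have "(norm (w - (\<gamma> * t) *\<^sub>R d))\<^sup>2
      = (norm w)\<^sup>2 - 2 * (\<gamma> * t) * inner d w + (\<gamma> * t)\<^sup>2 * (norm d)\<^sup>2"
    by (simp only: power2_norm_eq_inner)
      (simp add: inner_diff_left inner_diff_right inner_commute power2_eq_square algebra_simps)
  ultimately show ?thesis
    by (simp add: w_def algebra_simps)
qed

section \<open>Weak limits of minimizing sequences\<close>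

text \<open>The variational inequality at the proximal point \<open>p\<close> of \<open>w\<close> is
  affine in the tested point, so it survives the weak limit. It then bounds the squared distance of
  \<open>w\<close> and \<open>p\<close> by \<open>m - a \<le> 0\<close>.\<close>

lemma weak_limit_of_minimizing_sequence:
  fixes F :: "'a::{real_inner, complete_space} \<Rightarrow> ereal"
  assumes F: "convex_ereal F" "proper_fun F" "lower_semicont F"
    and below: "\<And>u. ereal m \<le> F u"
    and u: "weakly_converges u w" and b: "b \<longlonglongrightarrow> m" and Fu: "eventually (\<lambda>n. F (u n) = ereal (b n)) sequentially"
  shows "F w = ereal m"
proof -
  have "ereal m \<le> F v + ereal (1 / (2 * 1) * (norm (v - w))\<^sup>2)" for v
    using add_mono[OF below[of v], of 0 "ereal (1 / (2 * 1) * (norm (v - w))\<^sup>2)"] by simp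
  from prox_variational[OF F zero_less_one this]
  obtain a p where a: "F p = ereal a"
    and var: "\<And>v b. F v = ereal b \<Longrightarrow> a + inner (w - p) (v - p) \<le> b"
    by (metis div_by_1)
  have "(\<lambda>n. \<phi> (u n)) \<longlonglongrightarrow> \<phi> w" if "bounded_linear \<phi>" for \<phi> :: "'a \<Rightarrow> real"
    using u that unfolding weakly_converges_def by blast
  from this[OF bounded_linear_inner_right]
  have "(\<lambda>n. inner (w - p) (u n)) \<longlonglongrightarrow> inner (w - p) w" .
  then have "(\<lambda>n. a + (inner (w - p) (u n) - inner (w - p) p)) \<longlonglongrightarrow> a + (inner (w - p) w - inner (w - p) p)"
    by (intro tendsto_add tendsto_diff tendsto_const)
  moreover have "eventually (\<lambda>n. a + (inner (w - p) (u n) - inner (w - p) p) \<le> b n) sequentially"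
    using Fu by eventually_elim (use var in \<open>simp add: inner_diff_right\<close>)
  ultimately have "a + (inner (w - p) w - inner (w - p) p) \<le> m"
    using b by (intro tendsto_le[OF sequentially_bot, of b m])
  then have "a + (norm (w - p))\<^sup>2 \<le> m"
    by (simp add: power2_norm_eq_inner flip: inner_diff_right)
  moreover have "m \<le> a" using below[of p] a by simp
  ultimately have "(norm (w - p))\<^sup>2 \<le> 0" "a = m"
    using zero_le_power2[of "norm (w - p)"] by linarith+
  then show ?thesis using a by simp
qed

section \<open>Energy decrease, convergence rate and weak limit points\<close>

theorem theorem2:
  fixes f :: "'a::{real_inner, complete_space} \<Rightarrow> real"
    and g F :: "'a \<Rightarrow> ereal"
    and L s \<gamma> :: real
    and x y z :: "nat \<Rightarrow> 'a"
    and xstar :: 'a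
  assumes "L > 0"
    and "convex_on UNIV f" and "L_smooth L f"
    and "convex_ereal g" and "proper_fun g" and "lower_semicont g"
    and "F = composite f g"
    and "is_arg_min F (\<lambda>_. True) xstar"
    and "0 < s" and "s \<le> 1 / L"
    and "0 < \<gamma>" and "\<gamma> \<le> 2 - s * L"
    and "generated_by_MAPM f g s \<gamma> x y z"
  shows "(\<forall>k\<ge>1. F (y k) - F xstar
            \<le> ereal ((norm (x 0 - xstar))\<^sup>2 / (2 * \<gamma> * s * tseq k * (tseq k - 1))))
       \<and> (\<forall>w. weak_subseq_limit_point y w \<longrightarrow> is_arg_min F (\<lambda>_. True) w)"
proof -
  have min: "F xstar \<le> F u" for u
    using assms(8) by (auto simp: is_arg_min_def not_less)
  have propF: "proper_fun F"
    using assms(5,7) by (simp add: proper_fun_composite)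
  obtain m where m: "F xstar = ereal m"
    using propF min unfolding proper_fun_def by (metis ereal_cases ereal_infty_less_eq(1))
  have below: "ereal m \<le> composite f g u" for u
    using min[of u] m assms(7) by simp
  have upd: "z k = prox s g (x k - s *\<^sub>R gradient f (x k))"
    "y (Suc k) = (if F (z k) \<le> F (y k) then z k else y k)"
    "x (Suc k) = y (Suc k)
      + ((tseq k - 1) / tseq (Suc k)) *\<^sub>R (y (Suc k) - y k)
      + (tseq k / tseq (Suc k)) *\<^sub>R (z k - y (Suc k))
      + (tseq k * (\<gamma> - 1) / tseq (Suc k)) *\<^sub>R (z k - x k)" for k
    using assms(7,13) unfolding generated_by_MAPM_def by auto
  have "\<exists>c. F (z k) = ereal c \<and> (\<forall>u b. F u = ereal b \<longrightarrow>
      c + inner (x k - z k) (u - x k) / s + (2 - s * L) / (2 * s) * (norm (x k - z k))\<^sup>2 \<le> b)" for k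
    using prox_gradient_inequality[OF assms(2-6,1,9,10) below upd(1)] unfolding assms(7) by metis
  then obtain c where c: "\<And>k. F (z k) = ereal (c k)"
    and ineq: "\<And>k u b. F u = ereal b \<Longrightarrow>
      c k + inner (x k - z k) (u - x k) / s + (2 - s * L) / (2 * s) * (norm (x k - z k))\<^sup>2 \<le> b"
    by metis
  have t1: "1 \<le> tseq k" for k
    using tseq_ge[of k] by simp
  \<comment> \<open>Either branch of the update stays at or below the finite value
    \<open>F (z k)\<close>, so every iterate after \<open>y 0\<close> has finite value.\<close>
  have FySuc: "F (y (Suc k)) \<le> ereal (c k)" for k
    using upd(2)[of k] c[of k] by (auto simp: not_le less_imp_le)
  have fin: "F (y (Suc k)) = ereal (real_of_ereal (F (y (Suc k))))" for k
    using FySuc[of k] propF by (cases "F (y (Suc k))") (auto simp: proper_fun_def)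
  \<comment> \<open>\<open>real_of_ereal\<close> sends infinity to 0, so \<open>\<delta> 0\<close>
    may be a mere placeholder; its weight in \<open>E 0\<close> is zero.\<close>
  define \<delta> where "\<delta> k = real_of_ereal (F (y k)) - m" for k
  have Fy: "F (y k) = ereal (\<delta> k + m)" if "k \<ge> 1" for k
    using fin[of "k - 1"] that by (simp add: \<delta>_def)
  define w where "w k = tseq k *\<^sub>R x k - (tseq k - 1) *\<^sub>R y k - xstar" for k
  \<comment> \<open>After scaling by \<open>tseq (Suc k)\<close>, the multiples of
    \<open>y (Suc k)\<close> cancel, leaving a relaxed step from \<open>x k\<close> towards
    \<open>z k\<close>.\<close>
  have wSuc: "w (Suc k) = w k - (\<gamma> * tseq k) *\<^sub>R (x k - z k)" for k
  proof -
    have "tseq (Suc k) \<noteq> 0" using t1[of "Suc k"] by linarith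
    then have "tseq (Suc k) *\<^sub>R x (Suc k) = tseq (Suc k) *\<^sub>R y (Suc k)
        + (tseq k - 1) *\<^sub>R (y (Suc k) - y k) + tseq k *\<^sub>R (z k - y (Suc k))
        + (tseq k * (\<gamma> - 1)) *\<^sub>R (z k - x k)"
      unfolding upd(3)[of k] by (simp add: scaleR_add_right del: tseq.simps)
    then show ?thesis
      unfolding w_def by (simp add: algebra_simps del: tseq.simps)
  qed
  define E where "E k = 2 * \<gamma> * s * (tseq k * (tseq k - 1)) * \<delta> k + (norm (w k))\<^sup>2" for k
  have "E (Suc k) \<le> E k" for k
  proof -
    have "\<delta> (Suc k) \<le> c k - m"
      using FySuc[of k] Fy[of "Suc k"] by simp
    then have "E (Suc k) \<le> 2 * \<gamma> * s * (tseq k)\<^sup>2 * (c k - m) + (norm (w (Suc k)))\<^sup>2"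
      using assms(9,11) unfolding E_def tseq_Suc_mult
      by (intro add_right_mono mult_left_mono) auto
    also have "\<dots> \<le> E k"
      unfolding wSuc E_def unfolding w_def
    proof (rule MAPM_step[OF assms(9,11,12) t1 refl])
      show "c k - m + inner (x k - z k) (xstar - x k) / s
          + (2 - s * L) / (2 * s) * (norm (x k - z k))\<^sup>2 \<le> 0"
        using ineq[OF m, of k] by linarith
      assume "tseq k \<noteq> 1"
      \<comment> \<open>Excluding index 0 makes \<open>F (y k)\<close> finite, as
        \<open>ineq\<close> requires.\<close>
      then have "k \<ge> 1" by (cases k) auto
      then show "c k - m + inner (x k - z k) (y k - x k) / s
          + (2 - s * L) / (2 * s) * (norm (x k - z k))\<^sup>2 \<le> \<delta> k"
        using ineq[OF Fy, of k k] by linarith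
    qed
    finally show ?thesis .
  qed
  then have "E k \<le> E 0" for k
    by (simp add: lift_Suc_antimono_le)
  also have "E 0 = (norm (x 0 - xstar))\<^sup>2"
    by (simp add: E_def w_def)
  finally have Ele: "2 * \<gamma> * s * (tseq k * (tseq k - 1)) * \<delta> k \<le> (norm (x 0 - xstar))\<^sup>2" for k
    using E_def[of k] zero_le_power2[of "norm (w k)"] by (metis add_le_cancel_left add.right_neutral order_trans)
  have rate: "\<delta> k \<le> (norm (x 0 - xstar))\<^sup>2 / (2 * \<gamma> * s * tseq k * (tseq k - 1))" if "k \<ge> 1" for k
  proof -
    have "tseq k > 1" using tseq_ge[of k] that by simp
    then have "2 * \<gamma> * s * tseq k * (tseq k - 1) > 0"
      using assms(9,11) by simp
    then show ?thesis
      using Ele[of k] by (simp add: pos_le_divide_eq mult_ac)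
  qed
  have \<delta>0: "\<delta> k \<ge> 0" if "k \<ge> 1" for k
    using min[of "y k"] m Fy[OF that] by simp
  define K where "K = (norm (x 0 - xstar))\<^sup>2 / (2 * \<gamma> * s)"
  \<comment> \<open>At index \<open>Suc k\<close> the weight is the square of \<open>tseq k\<close>,
    which dominates \<open>tseq k\<close> itself; the resulting bound of order 1/k suffices for the
    limit.\<close>
  have \<delta>_le: "\<delta> (Suc k) \<le> K * (2 * inverse (real (Suc k)))" for k
  proof -
    have t: "real (Suc k) / 2 \<le> (tseq k)\<^sup>2"
      using tseq_ge[of k] self_le_power[OF t1, of 2 k] by simp
    have "(tseq k)\<^sup>2 * \<delta> (Suc k) \<le> K"
      using Ele[of "Suc k"] assms(9,11) unfolding tseq_Suc_mult K_def
      by (subst pos_le_divide_eq) (simp_all add: mult_ac)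
    moreover have "real (Suc k) / 2 * \<delta> (Suc k) \<le> (tseq k)\<^sup>2 * \<delta> (Suc k)"
      using \<delta>0[of "Suc k"] by (intro mult_right_mono t) simp
    ultimately have "real (Suc k) / 2 * \<delta> (Suc k) \<le> K" by linarith
    then show ?thesis by (simp add: field_simps)
  qed
  have "(\<lambda>k. K * (2 * inverse (real (Suc k)))) \<longlonglongrightarrow> K * (2 * 0)"
    by (intro tendsto_intros LIMSEQ_inverse_real_of_nat)
  then have "(\<lambda>k. \<delta> (Suc k)) \<longlonglongrightarrow> 0"
    using \<delta>0 \<delta>_le
    by (intro tendsto_sandwich[of "\<lambda>_. 0" "\<lambda>k. \<delta> (Suc k)" sequentially "\<lambda>k. K * (2 * inverse (real (Suc k)))"]
        always_eventually allI) simp_all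
  then have \<delta>_lim: "\<delta> \<longlonglongrightarrow> 0"
    by (simp only: filterlim_sequentially_Suc)
  show ?thesis
  proof (intro conjI allI impI)
    fix k :: nat assume "1 \<le> k"
    with rate[of k] show "F (y k) - F xstar
        \<le> ereal ((norm (x 0 - xstar))\<^sup>2 / (2 * \<gamma> * s * tseq k * (tseq k - 1)))"
      by (simp add: Fy m)
  next
    fix v assume "weak_subseq_limit_point y v"
    then obtain r where r: "strict_mono r" "weakly_converges (y \<circ> r) v"
      unfolding weak_subseq_limit_point_def by blast
    have "(\<lambda>n. (\<delta> \<circ> r) n + m) \<longlonglongrightarrow> 0 + m"
      by (intro tendsto_intros LIMSEQ_subseq_LIMSEQ \<delta>_lim r(1))
    then have b: "(\<lambda>n. \<delta> (r n) + m) \<longlonglongrightarrow> m" by simp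
    \<comment> \<open>\<open>r 0\<close> may be 0, where the value may be infinite; for
      \<open>n \<ge> 1\<close>, \<open>r n \<ge> n\<close> avoids this.\<close>
    have "eventually (\<lambda>n. F ((y \<circ> r) n) = ereal (\<delta> (r n) + m)) sequentially"
      using eventually_ge_at_top[of 1]
      by eventually_elim (metis Fy comp_apply order_trans seq_suble[OF r(1)])
    moreover have "continuous_on UNIV f"
      using assms(3) differentiable_imp_continuous_within
      by (auto simp: L_smooth_def continuous_on_eq_continuous_at)
    then have "lower_semicont F"
      unfolding assms(7) using assms(6,5) by (rule lower_semicont_continuous_add)
    moreover have "convex_ereal F"
      unfolding assms(7) using assms(2,4,5) by (rule convex_ereal_add)
    moreover have "ereal m \<le> F u" for u using min[of u] m by simp
    ultimately have "F v = ereal m"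
      by (intro weak_limit_of_minimizing_sequence[OF _ propF _ _ r(2) b])
    then show "is_arg_min F (\<lambda>_. True) v"
      using min m by (auto simp: is_arg_min_def not_less)
  qed
qed

end
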